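(* Let $K$, $L$ be two convex bodies in $\mathbb{R}^n$ and $\lambda\in(0,1)$. Then $$\big|(\lambda\cdot K+_0(1-\lambda)\cdot L)^{\circ}\big|\ \le\ |K^{\circ}|^{\lambda}|L^{\circ}|^{1-\lambda}.$$
   Context: A convex body in $\mathbb{R}^n$ is a compact convex set with non-empty interior (not necessarily symmetric). $|\cdot|$ is $n$-dimensional Lebesgue measure, with the value $+\infty$ allowed. Support function: $h_K(u)=\max_{y\in K}u\cdot y$; polar set: $K^{\circ}=\{x\in\mathbb{R}^n: x\cdot y\le 1\ \forall y\in K\}$. The logarithmic convex combination is $$\lambda\cdot K+_0(1-\lambda)\cdot L=\{x\in\mathbb{R}^n : x\cdot u\le h_K(u)^{\lambda}h_L(u)^{1-\lambda}\ \text{for all } u\in S^{n-1}\},$$ where $S^{n-1}$ is the Euclidean unit sphere; this definition is made for bodies containing the origin in their interiors (so that $h_K,h_L>0$). If $K$ or $L$ does not contain the origin in its interior, its polar set has infinite volume, the right-hand side of the inequality is $+\infty$, and the assertion is regarded as trivial. *)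

theory Defs
  imports "HOL-Analysis.Analysis"
begin

definition convex_body :: "(real ^ 'n) set \<Rightarrow> bool" where
  "convex_body K \<longleftrightarrow> compact K \<and> convex K \<and> interior K \<noteq> {}"

definition support_fun :: "(real ^ 'n) set \<Rightarrow> real ^ 'n \<Rightarrow> real" where
  "support_fun K u = (SUP y\<in>K. u \<bullet> y)"

lemma support_fun_is_max:
  assumes "convex_body K"
  shows "\<exists>y\<in>K. support_fun K u = u \<bullet> y \<and> (\<forall>z\<in>K. u \<bullet> z \<le> u \<bullet> y)"
proof -
  have K: "compact K" "K \<noteq> {}"
    using assms by (auto simp: convex_body_def)
  have "continuous_on K (\<lambda>y. u \<bullet> y)"
    by (intro continuous_intros)
  from continuous_attains_sup[OF K this]
  obtain y where y: "y \<in> K" "\<forall>z\<in>K. u \<bullet> z \<le> u \<bullet> y"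
    by blast
  have "support_fun K u = u \<bullet> y"
    unfolding support_fun_def by (intro cSup_eq_maximum) (use y in auto)
  with y show ?thesis by blast
qed

definition polar_set :: "(real ^ 'n) set \<Rightarrow> (real ^ 'n) set" where
  "polar_set K = {x. \<forall>y\<in>K. x \<bullet> y \<le> 1}"

text \<open>The logarithmic combination \<open>\<lambda> \<cdot> K +\<^sub>0 (1 - \<lambda>) \<cdot> L\<close>. It is meaningful only if the
  origin is interior to both bodies, since then both support functions are positive on the
  sphere; otherwise \<open>powr\<close> may be applied to nonpositive reals and the set has no significance.\<close>

definition log_comb :: "real \<Rightarrow> (real ^ 'n) set \<Rightarrow> (real ^ 'n) set \<Rightarrow> (real ^ 'n) set" where
  "log_comb l K L =
     {x. \<forall>u\<in>sphere 0 1. x \<bullet> u \<le> support_fun K u powr l * support_fun L u powr (1 - l)}"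

text \<open>Real powers of extended nonnegative reals, with \<open>\<infinity>\<close> raised to the exponent \<open>a\<close> equal to
  \<open>\<infinity>\<close>; intended for \<open>a > 0\<close> only.\<close>

definition ennpowr :: "ennreal \<Rightarrow> real \<Rightarrow> ennreal" where
  "ennpowr x a = (if x = \<infinity> then \<infinity> else ennreal (enn2real x powr a))"

end

theory Submission
  imports Defs
begin

text \<open>
  Write \<open>f = h\<^sub>K\<^sup>l h\<^sub>L\<^sup>1\<^sup>-\<^sup>l\<close>. The polar of the logarithmic combination is the closed convex hull of the
  points \<open>u / f u\<close>, so its volume is the limit of volumes of hulls \<open>P\<close> of the origin and finitely many
  points \<open>v i = u i / f (u i)\<close>. Triangulate \<open>P\<close> by simplices with one vertex at the origin and the other
  vertices among the \<open>v i\<close>. If \<open>v i\<close> is moved along its ray to \<open>u i / h\<^sub>K (u i)\<close>, which lies in the polar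
  of \<open>K\<close>, the simplices stay in their cones, hence remain non-overlapping, and each volume is
  multiplied by the product of the scaling factors of its vertices; likewise for \<open>L\<close>. Hence
  \<open>|P| = \<Sum>\<^sub>I a\<^sub>I\<^sup>l b\<^sub>I\<^sup>1\<^sup>-\<^sup>l\<close>, where \<open>a\<^sub>I\<close> and \<open>b\<^sub>I\<close> are the volumes of disjoint simplices inside the two
  polars, and Hoelder's inequality finishes the proof.

  The triangulation comes from linear programming: every point of the cone over the \<open>v i\<close> has a unique
  nonnegative representation \<open>\<Sum>i. c i * v i\<close> that minimises \<open>\<Sum>i. c i\<close> and, among those, is
  lexicographically least. The faces are the supports of these representations.
\<close>

section \<open>Lexicographically minimal representations\<close>

text \<open>Strictly positive cone of a translation-invariant total order on coefficient vectors of
  length \<open>N\<close>. A difference \<open>c' - c\<close> in it means that \<open>c'\<close> is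
  the worse representation. The sum comes first so that coefficient sums never grow; the
  lexicographic tie-break makes minimisers unique.\<close>

definition lex_pos :: "nat \<Rightarrow> (nat \<Rightarrow> real) \<Rightarrow> bool" where
  "lex_pos N d \<longleftrightarrow> 0 < sum d {..<N} \<or>
     sum d {..<N} = 0 \<and> (\<exists>i<N. 0 < d i \<and> (\<forall>j<i. d j = 0))"

lemma lex_pos_nonneg_sum: "lex_pos N d \<Longrightarrow> 0 \<le> sum d {..<N}"
  by (auto simp: lex_pos_def)

lemma lex_pos_exists_pos:
  assumes "lex_pos N d"
  shows "\<exists>i<N. 0 < d i"
proof (rule ccontr)
  assume *: "\<not> (\<exists>i<N. 0 < d i)"
  then have "sum d {..<N} \<le> 0"
    by (intro sum_nonpos) (meson lessThan_iff not_less)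
  with * assms show False
    by (auto simp: lex_pos_def)
qed

lemma lex_pos_total:
  assumes "\<exists>i<N. d i \<noteq> 0"
  shows "lex_pos N d \<or> lex_pos N (\<lambda>i. - d i)"
proof -
  \<comment> \<open>If the sum vanishes, the sign of the first nonzero entry decides between
    \<open>d\<close> and its negative.\<close>
  define k where "k = (LEAST i. i < N \<and> d i \<noteq> 0)"
  have k: "k < N \<and> d k \<noteq> 0"
    unfolding k_def by (rule LeastI_ex) (use assms in blast)
  have "d j = 0" if "j < k" for j
    using not_less_Least[of j "\<lambda>i. i < N \<and> d i \<noteq> 0"] that k by (auto simp: k_def)
  with k show ?thesis
    unfolding lex_pos_def sum_negf by (smt (verit))
qed

lemma lex_pos_add:
  assumes "lex_pos N d" "lex_pos N e"
  shows "lex_pos N (\<lambda>i. d i + e i)"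
proof (cases "sum d {..<N} = 0 \<and> sum e {..<N} = 0")
  case True
  with assms obtain i j where i: "i < N" "0 < d i" "\<forall>k<i. d k = 0"
    and j: "j < N" "0 < e j" "\<forall>k<j. e k = 0"
    by (auto simp: lex_pos_def)
  consider "i < j" | "i = j" | "j < i" by linarith
  then have "\<exists>m<N. 0 < d m + e m \<and> (\<forall>k<m. d k + e k = 0)"
  proof cases
    case 1 with i j show ?thesis by (intro exI[of _ i]) auto
  next
    case 2 with i j show ?thesis by (intro exI[of _ i]) auto
  next
    case 3 with i j show ?thesis by (intro exI[of _ j]) auto
  qed
  with True show ?thesis by (auto simp: lex_pos_def sum.distrib)
next
  case False
  with assms[THEN lex_pos_nonneg_sum] show ?thesis
    by (auto simp: lex_pos_def sum.distrib)
qed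

lemma not_lex_pos_zero: "\<not> lex_pos N (\<lambda>i. 0)"
  using lex_pos_exists_pos by fastforce

lemma lex_pos_scale:
  assumes "0 < t"
  shows "lex_pos N (\<lambda>i. t * d i) \<longleftrightarrow> lex_pos N d"
  using assms by (simp add: lex_pos_def zero_less_mult_iff flip: sum_distrib_left)

section \<open>Nonnegative representations and their minimality\<close>

text \<open>Vanishing from \<open>N\<close> on lets equality of functions stand for equality of
  coefficient vectors.\<close>

definition nonneg_coeffs :: "nat \<Rightarrow> (nat \<Rightarrow> real) set" where
  "nonneg_coeffs N = {c. (\<forall>i. 0 \<le> c i) \<and> (\<forall>i\<ge>N. c i = 0)}"

definition lincomb :: "(nat \<Rightarrow> 'a::real_vector) \<Rightarrow> nat \<Rightarrow> (nat \<Rightarrow> real) \<Rightarrow> 'a" where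
  "lincomb v N c = (\<Sum>i<N. c i *\<^sub>R v i)"

lemma lincomb_add: "lincomb v N (\<lambda>i. c i + d i) = lincomb v N c + lincomb v N d"
  and lincomb_diff: "lincomb v N (\<lambda>i. c i - d i) = lincomb v N c - lincomb v N d"
  and lincomb_scale: "lincomb v N (\<lambda>i. t * c i) = t *\<^sub>R lincomb v N c"
  by (simp_all add: lincomb_def scaleR_left_distrib scaleR_left_diff_distrib sum.distrib
      sum_subtractf scaleR_sum_right)

definition lex_min :: "(nat \<Rightarrow> 'a::real_vector) \<Rightarrow> nat \<Rightarrow> (nat \<Rightarrow> real) \<Rightarrow> bool" where
  "lex_min v N c \<longleftrightarrow> c \<in> nonneg_coeffs N \<and>
     (\<forall>c'\<in>nonneg_coeffs N. lincomb v N c' = lincomb v N c \<longrightarrow> c' \<noteq> c \<longrightarrow>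
        lex_pos N (\<lambda>i. c' i - c i))"

text \<open>Independence of the indexed family, not of its set of values, so that a repeated vector
  counts as a dependence.\<close>

definition indep_on :: "(nat \<Rightarrow> 'a::real_vector) \<Rightarrow> nat \<Rightarrow> nat set \<Rightarrow> bool" where
  "indep_on v N I \<longleftrightarrow> (\<forall>d. (\<forall>i. i \<notin> I \<longrightarrow> d i = 0) \<longrightarrow> lincomb v N d = 0 \<longrightarrow> d = (\<lambda>i. 0))"

text \<open>Antisymmetry of the order: two different minimisers would make a vector and its negative
  both positive, hence also their sum \<open>0\<close>.\<close>

lemma lex_min_unique:
  assumes "lex_min v N c" "lex_min v N c'" "lincomb v N c = lincomb v N c'"
  shows "c = c'"
proof (rule ccontr)
  assume "c \<noteq> c'"
  with assms have "lex_pos N (\<lambda>i. c' i - c i)" "lex_pos N (\<lambda>i. c i - c' i)"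
    by (auto simp: lex_min_def)
  from lex_pos_add[OF this] show False
    using not_lex_pos_zero by simp
qed

text \<open>Optimality only concerns the directions that are feasible at \<open>c\<close>, and these can only become
  fewer when the support shrinks.\<close>

lemma lex_min_support_mono:
  assumes c: "lex_min v N c" and b: "b \<in> nonneg_coeffs N"
    and supp: "\<And>i. c i = 0 \<Longrightarrow> b i = 0"
  shows "lex_min v N b"
  unfolding lex_min_def
proof (intro conjI ballI impI)
  fix b' assume b': "b' \<in> nonneg_coeffs N" "lincomb v N b' = lincomb v N b" "b' \<noteq> b"
  define d where "d = (\<lambda>i. b' i - b i)"
  have c0: "c \<in> nonneg_coeffs N" using c by (simp add: lex_min_def)
  \<comment> \<open>A short move from \<open>c\<close> in direction \<open>d\<close> is feasible:
    where \<open>c i = 0\<close>, also \<open>b i = 0\<close>, so \<open>d i = b' i\<close> is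
    nonnegative; elsewhere \<open>c i\<close> is positive and leaves room. The induction takes a
    minimum over the indices.\<close>
  have "\<exists>\<epsilon>>0. \<forall>i<m. 0 \<le> c i + \<epsilon> * d i" for m
  proof (induction m)
    case 0
    show ?case by (auto intro: exI[of _ 1])
  next
    case (Suc m)
    then obtain e where e: "0 < e" "\<forall>i<m. 0 \<le> c i + e * d i" by auto
    have step: "\<exists>e'>0. 0 \<le> c m + e' * d m"
    proof (cases "c m = 0")
      case True
      then show ?thesis using supp b'(1)
        by (intro exI[of _ 1]) (auto simp: d_def nonneg_coeffs_def)
    next
      case False
      then have "0 < c m" using c0 by (auto simp: nonneg_coeffs_def less_le)
      \<comment> \<open>This step changes entry \<open>m\<close> by less than \<open>c m\<close>;
        the \<open>1\<close> keeps the denominator positive when \<open>d m = 0\<close>.\<close>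
      then have "0 \<le> c m + c m / (\<bar>d m\<bar> + 1) * d m"
        by (simp add: field_simps) (smt (verit, best) mult_nonneg_nonneg mult_minus_right)
      with \<open>0 < c m\<close> show ?thesis by (intro exI[of _ "c m / (\<bar>d m\<bar> + 1)"]) auto
    qed
    then obtain e' where e': "0 < e'" "0 \<le> c m + e' * d m" by blast
    have shrink: "0 \<le> c i + min e e' * d i" if "0 \<le> c i + s * d i" "min e e' \<le> s" for i s
    proof (cases "0 \<le> d i")
      case True
      then show ?thesis using c0 e e' by (auto simp: nonneg_coeffs_def)
    next
      case False
      then have "s * d i \<le> min e e' * d i" using that by (intro mult_right_mono_neg) auto
      with that show ?thesis by linarith
    qed
    show ?case
    proof (intro exI[of _ "min e e'"] conjI allI impI)
      fix i assume "i < Suc m"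
      then show "0 \<le> c i + min e e' * d i"
        using shrink[of m e'] shrink[of i e] e e' by (cases "i = m") auto
    qed (use e e' in auto)
  qed
  then obtain \<epsilon> where \<epsilon>: "0 < \<epsilon>" "\<forall>i<N. 0 \<le> c i + \<epsilon> * d i" by blast
  \<comment> \<open>\<open>c'\<close> competes with \<open>c\<close> itself, so the optimality of
    \<open>c\<close> yields the positivity of \<open>d\<close>.\<close>
  define c' where "c' = (\<lambda>i. c i + \<epsilon> * d i)"
  have "c' \<in> nonneg_coeffs N"
    using \<epsilon> c0 b b'(1) unfolding nonneg_coeffs_def c'_def d_def
    by (auto simp: not_less) (metis add.right_neutral diff_self linorder_not_le mult_zero_right order.refl)
  moreover have "lincomb v N c' = lincomb v N c"
    using b'(2) by (simp add: c'_def d_def lincomb_add lincomb_scale lincomb_diff)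
  moreover have "c' \<noteq> c"
    using b'(3) \<epsilon> by (auto simp: c'_def d_def fun_eq_iff)
  ultimately have "lex_pos N (\<lambda>i. c' i - c i)"
    using c by (auto simp: lex_min_def)
  then have "lex_pos N (\<lambda>i. \<epsilon> * d i)" by (simp add: c'_def)
  then show "lex_pos N (\<lambda>i. b' i - b i)"
    using \<epsilon> by (simp add: lex_pos_scale d_def)
qed (rule b)

lemma finite_lex_least:
  assumes "finite X" "X \<noteq> {}" "X \<subseteq> nonneg_coeffs N"
  shows "\<exists>m\<in>X. \<forall>b\<in>X. b \<noteq> m \<longrightarrow> lex_pos N (\<lambda>i. b i - m i)"
  using assms
proof (induction X rule: finite_ne_induct)
  case (insert x F)
  then obtain m where m: "m \<in> F" "\<forall>b\<in>F. b \<noteq> m \<longrightarrow> lex_pos N (\<lambda>i. b i - m i)"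
    by auto
  have "x \<noteq> m" using m insert by auto
  \<comment> \<open>Both vanish from \<open>N\<close> on, so they differ below \<open>N\<close>, as
    \<open>lex_pos_total\<close> requires.\<close>
  moreover have "x i = m i" if "N \<le> i" for i
    using insert.prems m that by (auto simp: nonneg_coeffs_def)
  ultimately have "\<exists>i<N. x i - m i \<noteq> 0"
    by (metis ext eq_iff_diff_eq_0 not_le_imp_less)
  from lex_pos_total[OF this] show ?case
  proof
    assume "lex_pos N (\<lambda>i. x i - m i)"
    with m show ?thesis by (intro bexI[of _ m]) auto
  next
    assume *: "lex_pos N (\<lambda>i. - (x i - m i))"
    show ?thesis
    proof (intro bexI[of _ x] ballI impI)
      fix b assume "b \<in> insert x F" "b \<noteq> x"
      then show "lex_pos N (\<lambda>i. b i - x i)"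
        using m(2) * lex_pos_add[OF _ *, of "\<lambda>i. b i - m i"] by (cases "b = m") auto
    qed auto
  qed
qed auto

text \<open>The usual Caratheodory reduction; the sign of the linear dependency is chosen so that
  removing it decreases the objective.\<close>

lemma lex_reduce_to_basic:
  assumes "c \<in> nonneg_coeffs N"
  shows "\<exists>b\<in>nonneg_coeffs N. lincomb v N b = lincomb v N c \<and> indep_on v N {i. b i \<noteq> 0} \<and>
           (b = c \<or> lex_pos N (\<lambda>i. c i - b i))"
  using assms
proof (induction "card {i. c i \<noteq> 0}" arbitrary: c rule: less_induct)
  case less
  show ?case
  proof (cases "indep_on v N {i. c i \<noteq> 0}")
    case True
    then show ?thesis using less by blast
  next
    case False
    then obtain d0 where d0: "\<And>i. c i = 0 \<Longrightarrow> d0 i = 0" "lincomb v N d0 = 0" "d0 \<noteq> (\<lambda>i. 0)"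
      by (auto simp: indep_on_def)
    have c: "\<And>i. 0 \<le> c i" "\<And>i. N \<le> i \<Longrightarrow> c i = 0"
      using less.prems by (auto simp: nonneg_coeffs_def)
    have "\<exists>i<N. d0 i \<noteq> 0" using d0 c by (meson ext not_le_imp_less)
    then have "\<exists>d. (\<forall>i. c i = 0 \<longrightarrow> d i = 0) \<and> lincomb v N d = 0 \<and> lex_pos N d"
      using lex_pos_total[of N d0] d0 lincomb_scale[of v N "-1" d0] by (auto intro: exI[of _ "\<lambda>i. - d0 i"])
    then obtain d where d: "\<And>i. c i = 0 \<Longrightarrow> d i = 0" "lincomb v N d = 0" "lex_pos N d" by blast
    define J where "J = {i. i < N \<and> 0 < d i}"
    have J: "finite J" "J \<noteq> {}"
      using lex_pos_exists_pos[OF d(3)] by (auto simp: J_def)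
    \<comment> \<open>Ratio test: \<open>t\<close> is the largest multiple of \<open>d\<close> that
      can be subtracted while keeping all coefficients nonnegative. The index \<open>k\<close>
      attaining the minimum then drops out of the support.\<close>
    define t where "t = Min ((\<lambda>i. c i / d i) ` J)"
    have "t \<in> (\<lambda>i. c i / d i) ` J" unfolding t_def using J by (intro Min_in) auto
    then obtain k where k: "k \<in> J" "t = c k / d k" by blast
    have tle: "t \<le> c i / d i" if "i \<in> J" for i
      unfolding t_def using J that by (intro Min_le) auto
    have ck: "0 < c k" "0 < d k" using k d(1)[of k] c(1)[of k] by (auto simp: J_def less_le)
    then have t: "0 < t" using k by simp
    define c' where "c' = (\<lambda>i. c i - t * d i)"
    have c'0: "c' \<in> nonneg_coeffs N"
      unfolding nonneg_coeffs_def
    proof (safe)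
      fix i
      show "0 \<le> c' i"
      proof (cases "i \<in> J")
        case True
        then show ?thesis using tle[OF True] by (auto simp: c'_def J_def field_simps)
      next
        case False
        then have "d i \<le> 0" using d(1)[of i] c(2)[of i] by (force simp: J_def)
        then have "t * d i \<le> 0" using t by (simp add: mult_nonneg_nonpos)
        then show ?thesis using c(1)[of i] by (simp add: c'_def)
      qed
    next
      fix i assume "N \<le> i"
      then show "c' i = 0" using c(2) d(1) by (simp add: c'_def)
    qed
    have lc': "lincomb v N c' = lincomb v N c"
      by (simp add: c'_def lincomb_diff lincomb_scale d)
    have "finite {i. c i \<noteq> 0}"
      by (rule finite_subset[of _ "{..<N}"]) (use c(2) in \<open>auto simp: not_le[symmetric]\<close>)
    moreover have "{i. c' i \<noteq> 0} \<subset> {i. c i \<noteq> 0}"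
    proof
      show "{i. c' i \<noteq> 0} \<subseteq> {i. c i \<noteq> 0}" using d(1) by (auto simp: c'_def)
      have "c' k = 0" using k ck by (simp add: c'_def)
      moreover have "c k \<noteq> 0" using ck by simp
      ultimately show "{i. c' i \<noteq> 0} \<noteq> {i. c i \<noteq> 0}" by blast
    qed
    ultimately have "card {i. c' i \<noteq> 0} < card {i. c i \<noteq> 0}"
      by (rule psubset_card_mono)
    from less.hyps[OF this c'0] obtain b where b: "b \<in> nonneg_coeffs N"
      "lincomb v N b = lincomb v N c" "indep_on v N {i. b i \<noteq> 0}"
      "b = c' \<or> lex_pos N (\<lambda>i. c' i - b i)"
      using lc' by auto
    have "lex_pos N (\<lambda>i. c i - c' i)" using d(3) t by (simp add: c'_def lex_pos_scale)
    then have "lex_pos N (\<lambda>i. c i - b i)"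
      using b(4) lex_pos_add[of N "\<lambda>i. c i - c' i" "\<lambda>i. c' i - b i"] by auto
    with b show ?thesis by blast
  qed
qed

text \<open>Basic representations, those with independent support, are determined by their supports,
  so there are finitely many and one of them is least. Every representation reduces to a basic one
  that is no worse, so the least basic one is least among all.\<close>

lemma lex_min_exists:
  assumes c: "c \<in> nonneg_coeffs N"
  shows "\<exists>b. lex_min v N b \<and> lincomb v N b = lincomb v N c \<and> sum b {..<N} \<le> sum c {..<N}"
proof -
  define X where "X = {b \<in> nonneg_coeffs N. lincomb v N b = lincomb v N c \<and> indep_on v N {i. b i \<noteq> 0}}"
  have "inj_on (\<lambda>b. {i. b i \<noteq> 0}) X"
  proof (rule inj_onI)
    \<comment> \<open>With equal supports, the difference is a linear dependence on an independent
      index set.\<close>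
    fix a b assume ab: "a \<in> X" "b \<in> X" "{i. a i \<noteq> 0} = {i. b i \<noteq> 0}"
    have "\<forall>i. i \<notin> {i. a i \<noteq> 0} \<longrightarrow> a i - b i = 0" using ab(3) by auto
    moreover have "lincomb v N (\<lambda>i. a i - b i) = 0" using ab by (simp add: X_def lincomb_diff)
    ultimately have "(\<lambda>i. a i - b i) = (\<lambda>i. 0)"
      using ab(1) unfolding X_def indep_on_def
      by (elim CollectE conjE allE[of _ "\<lambda>i. a i - b i"]) simp
    then show "a = b" by (auto simp: fun_eq_iff)
  qed
  moreover have "(\<lambda>b. {i. b i \<noteq> 0}) ` X \<subseteq> Pow {..<N}"
    by (auto simp: X_def nonneg_coeffs_def not_le[symmetric])
  ultimately have "finite X"
    by (rule inj_on_finite) simp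
  moreover have red: "\<exists>b\<in>X. b = a \<or> lex_pos N (\<lambda>i. a i - b i)"
    if "a \<in> nonneg_coeffs N" "lincomb v N a = lincomb v N c" for a
    using lex_reduce_to_basic[OF that(1), of v] that by (auto simp: X_def)
  then have "X \<noteq> {}" using c by blast
  ultimately obtain m where m: "m \<in> X" "\<forall>b\<in>X. b \<noteq> m \<longrightarrow> lex_pos N (\<lambda>i. b i - m i)"
    using finite_lex_least[of X N] by (auto simp: X_def)
  have best: "lex_pos N (\<lambda>i. a i - m i)"
    if a: "a \<in> nonneg_coeffs N" "lincomb v N a = lincomb v N c" "a \<noteq> m" for a
  proof -
    obtain b where b: "b \<in> X" "b = a \<or> lex_pos N (\<lambda>i. a i - b i)" using red a by blast
    show ?thesis
    proof (cases "b = m \<or> b = a")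
      case True
      then show ?thesis using b a m by auto
    next
      case False
      then show ?thesis
        using b m lex_pos_add[of N "\<lambda>i. a i - b i" "\<lambda>i. b i - m i"] by auto
    qed
  qed
  have mX: "m \<in> nonneg_coeffs N" "lincomb v N m = lincomb v N c" using m by (auto simp: X_def)
  have "lex_min v N m" using best mX by (auto simp: lex_min_def)
  moreover have "sum m {..<N} \<le> sum c {..<N}"
  proof (cases "c = m")
    case False
    then show ?thesis using lex_pos_nonneg_sum[OF best[OF c]] by (simp add: sum_subtractf)
  qed simp
  ultimately show ?thesis using mX by blast
qed

text \<open>Otherwise the reduction to a basic representation would produce a strictly better
  competitor.\<close>

lemma lex_min_indep:
  assumes "lex_min v N c"
  shows "indep_on v N {i. c i \<noteq> 0}"
proof -
  obtain b where b: "b \<in> nonneg_coeffs N" "lincomb v N b = lincomb v N c"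
    "indep_on v N {i. b i \<noteq> 0}" "b = c \<or> lex_pos N (\<lambda>i. c i - b i)"
    using lex_reduce_to_basic[of c N v] assms by (auto simp: lex_min_def)
  have "b = c"
  proof (rule ccontr)
    assume "b \<noteq> c"
    then have "lex_pos N (\<lambda>i. c i - b i)" "lex_pos N (\<lambda>i. b i - c i)"
      using b assms by (auto simp: lex_min_def)
    from lex_pos_add[OF this] show False using not_lex_pos_zero by simp
  qed
  with b show ?thesis by simp
qed

lemma lincomb_eq_sum_subset:
  assumes "I \<subseteq> {..<N}" "\<And>i. i \<notin> I \<Longrightarrow> c i = 0"
  shows "lincomb v N c = (\<Sum>i\<in>I. c i *\<^sub>R v i)"
  unfolding lincomb_def using assms by (intro sum.mono_neutral_right) auto

lemma indep_on_card_le: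
  fixes v :: "nat \<Rightarrow> 'a::euclidean_space"
  assumes ind: "indep_on v N I" and I: "I \<subseteq> {..<N}"
  shows "card I \<le> DIM('a)"
proof -
  have fin: "finite I" using I finite_subset by blast
  have inj: "inj_on v I"
  proof (rule inj_onI, rule ccontr)
    fix i j assume ij: "i \<in> I" "j \<in> I" "v i = v j" "i \<noteq> j"
    \<comment> \<open>Equal vectors at \<open>i\<close> and \<open>j\<close> give the dependence
      with coefficients \<open>1\<close> and \<open>-1\<close>.\<close>
    define d :: "nat \<Rightarrow> real" where "d = (\<lambda>k. if k = i then 1 else if k = j then - 1 else 0)"
    have "lincomb v N d = (\<Sum>k\<in>{i, j}. d k *\<^sub>R v k)"
      by (rule lincomb_eq_sum_subset) (use ij I in \<open>auto simp: d_def\<close>)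
    also have "\<dots> = 0" using ij by (simp add: d_def)
    finally have "d = (\<lambda>k. 0)" using ind ij by (auto simp: indep_on_def d_def)
    then have "d i = 0" by simp
    then show False by (simp add: d_def)
  qed
  have "independent (v ` I)"
  proof
    assume "dependent (v ` I)"
    then obtain u w where u: "w \<in> v ` I" "u w \<noteq> 0" "(\<Sum>x\<in>v ` I. u x *\<^sub>R x) = 0"
      using fin by (auto simp: real_vector.dependent_finite)
    define d where "d = (\<lambda>i. if i \<in> I then u (v i) else 0)"
    have "lincomb v N d = (\<Sum>i\<in>I. d i *\<^sub>R v i)"
      by (rule lincomb_eq_sum_subset) (use I in \<open>auto simp: d_def\<close>)
    also have "\<dots> = 0" using u(3) by (simp add: sum.reindex[OF inj] d_def)
    finally have "d = (\<lambda>k. 0)" using ind by (auto simp: indep_on_def d_def)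
    then have "d i = 0" for i by simp
    then show False using u(1,2) unfolding d_def by (metis imageE)
  qed
  then have "card (v ` I) \<le> DIM('a)" using independent_bound by blast
  then show ?thesis using inj by (simp add: card_image)
qed

section \<open>The induced triangulation\<close>

text \<open>By \<open>lex_min_support_mono\<close>, minimality depends only on the support, so the
  indicator stands for every coefficient vector that is positive exactly on
  \<open>I\<close>.\<close>

definition lex_faces :: "(nat \<Rightarrow> 'a::real_vector) \<Rightarrow> nat \<Rightarrow> nat set set" where
  "lex_faces v N = {I. I \<subseteq> {..<N} \<and> lex_min v N (indicator I)}"

lemma finite_lex_faces: "finite (lex_faces v N)"
  by (rule finite_subset[of _ "Pow {..<N}"]) (auto simp: lex_faces_def)

lemma lex_faces_finite: "I \<in> lex_faces v N \<Longrightarrow> finite I"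
  by (auto simp: lex_faces_def intro: finite_subset)

lemma lex_faces_card_le:
  fixes v :: "nat \<Rightarrow> 'a::euclidean_space"
  assumes "I \<in> lex_faces v N"
  shows "card I \<le> DIM('a)"
proof -
  have "{i. indicator I i \<noteq> (0::real)} = I" by (auto simp: indicator_def)
  then have "indep_on v N I"
    using assms lex_min_indep[of v N "indicator I"] by (simp add: lex_faces_def)
  then show ?thesis
    using assms by (intro indep_on_card_le) (auto simp: lex_faces_def)
qed

text \<open>Both sides are minimal representations of the same point, so uniqueness identifies them
  and their supports. The coefficients are unbounded: the claim concerns whole cones and so persists
  when the vectors are moved along their rays.\<close>

lemma lex_faces_cones_disjoint:
  assumes I: "I \<in> lex_faces v N" "\<And>i. i \<in> I \<Longrightarrow> 0 < c i"
    and J: "J \<in> lex_faces v N" "\<And>i. i \<in> J \<Longrightarrow> 0 < d i"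
    and eq: "(\<Sum>i\<in>I. c i *\<^sub>R v i) = (\<Sum>i\<in>J. d i *\<^sub>R v i)"
  shows "I = J"
proof -
  have main: "lex_min v N (\<lambda>i. if i \<in> F then e i else 0) \<and>
      lincomb v N (\<lambda>i. if i \<in> F then e i else 0) = (\<Sum>i\<in>F. e i *\<^sub>R v i)"
    if F: "F \<in> lex_faces v N" and e: "\<And>i. i \<in> F \<Longrightarrow> 0 < e i" for F e
  proof
    have F': "F \<subseteq> {..<N}" "lex_min v N (indicator F)" using F by (auto simp: lex_faces_def)
    show "lex_min v N (\<lambda>i. if i \<in> F then e i else 0)"
    proof (rule lex_min_support_mono[OF F'(2)])
      show "(\<lambda>i. if i \<in> F then e i else 0) \<in> nonneg_coeffs N"
        using F'(1) e by (force simp: nonneg_coeffs_def)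
    qed (auto simp: indicator_def split: if_splits)
    show "lincomb v N (\<lambda>i. if i \<in> F then e i else 0) = (\<Sum>i\<in>F. e i *\<^sub>R v i)"
      by (subst lincomb_eq_sum_subset[OF F'(1)]) auto
  qed
  have "(\<lambda>i. if i \<in> I then c i else 0) = (\<lambda>i. if i \<in> J then d i else 0)"
    using main[OF I] main[OF J] eq by (intro lex_min_unique[of v N]) auto
  then have "(if i \<in> I then c i else 0) = (if i \<in> J then d i else 0)" for i
    by (rule fun_cong)
  then show ?thesis using I(2) J(2) by (auto split: if_splits) (metis less_irrefl)+
qed

text \<open>Strict positivity removes the facets through the origin, so that simplices of different
  faces become disjoint rather than merely non-overlapping. The empty index set yields
  \<open>{0}\<close>.\<close>

definition corner_simplex :: "(nat \<Rightarrow> 'a::real_vector) \<Rightarrow> nat set \<Rightarrow> 'a set" where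
  "corner_simplex v I = {\<Sum>i\<in>I. c i *\<^sub>R v i | c. (\<forall>i\<in>I. 0 < c i) \<and> sum c I \<le> 1}"

text \<open>Passing to the minimal representation does not increase the coefficient sum; this is why
  \<open>lex_pos\<close> compares sums first.\<close>

lemma lex_faces_cover:
  assumes "c \<in> nonneg_coeffs N" "sum c {..<N} \<le> 1"
  shows "\<exists>I\<in>lex_faces v N. lincomb v N c \<in> corner_simplex v I"
proof -
  obtain b where b: "lex_min v N b" "lincomb v N b = lincomb v N c" "sum b {..<N} \<le> sum c {..<N}"
    using lex_min_exists[OF assms(1)] by blast
  define I where "I = {i. b i \<noteq> 0}"
  have b0: "\<And>i. 0 \<le> b i" "\<And>i. N \<le> i \<Longrightarrow> b i = 0"
    using b(1) by (auto simp: lex_min_def nonneg_coeffs_def)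
  have I: "I \<subseteq> {..<N}" using b0(2) by (auto simp: I_def not_le[symmetric])
  have "lex_min v N (indicator I)"
    by (rule lex_min_support_mono[OF b(1)])
      (use b0 in \<open>auto simp: nonneg_coeffs_def indicator_def I_def\<close>)
  with I have "I \<in> lex_faces v N" by (simp add: lex_faces_def)
  moreover have "lincomb v N c \<in> corner_simplex v I"
    unfolding corner_simplex_def
  proof (intro CollectI exI[of _ b] conjI ballI)
    show "lincomb v N c = (\<Sum>i\<in>I. b i *\<^sub>R v i)"
      using lincomb_eq_sum_subset[OF I, of b v] b(2) by (auto simp: I_def)
    show "0 < b i" if "i \<in> I" for i using that b0(1)[of i] by (simp add: I_def less_le)
    have "sum b I = sum b {..<N}" by (rule sum.mono_neutral_left) (use I in \<open>auto simp: I_def\<close>)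
    then show "sum b I \<le> 1" using b assms by simp
  qed
  ultimately show ?thesis by blast
qed

text \<open>The remaining weight \<open>1 - sum c I\<close> is placed on the origin.\<close>

lemma corner_simplex_subset_convex:
  assumes "convex A" "0 \<in> A" "finite I" "\<And>i. i \<in> I \<Longrightarrow> v i \<in> A"
  shows "corner_simplex v I \<subseteq> A"
proof
  fix x assume "x \<in> corner_simplex v I"
  then obtain c where c: "x = (\<Sum>i\<in>I. c i *\<^sub>R v i)" "\<And>i. i \<in> I \<Longrightarrow> 0 < c i" "sum c I \<le> 1"
    by (auto simp: corner_simplex_def)
  define s where "s = sum c I"
  have s0: "0 \<le> s" unfolding s_def by (intro sum_nonneg) (use c(2) in force)
  show "x \<in> A"
  proof (cases "s = 0")
    case True
    then have "I = {}" using c(2) sum_pos[OF assms(3), of c] by (force simp: s_def)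
    then show ?thesis using c assms by simp
  next
    case False
    have "(\<Sum>i\<in>I. (c i / s) *\<^sub>R v i) \<in> A"
      using assms c(2) s0 False
      by (intro convex_sum) (auto simp: s_def[symmetric] sum_divide_distrib[symmetric] less_imp_le)
    then have "s *\<^sub>R (\<Sum>i\<in>I. (c i / s) *\<^sub>R v i) + (1 - s) *\<^sub>R 0 \<in> A"
      using assms(1,2) s0 c(3) by (intro convexD) (auto simp: s_def)
    moreover have "s *\<^sub>R (\<Sum>i\<in>I. (c i / s) *\<^sub>R v i) = x"
      using False by (simp add: scaleR_sum_right c(1))
    ultimately show ?thesis by simp
  qed
qed

section \<open>Volumes of simplices\<close>

lemma measure_shear_cbox:
  fixes a b :: "real^'n"
  assumes "m \<noteq> n"
  defines "h \<equiv> \<lambda>x::real^'n. \<chi> i. if i = m then x$m + x$n else x$i"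
  shows "measure lebesgue (h ` cbox a b) = measure lebesgue (cbox a b)"
proof (cases "cbox a b = {}")
  case False
  have lin: "linear h"
    unfolding h_def by (rule linearI) (auto simp: vec_eq_iff algebra_simps)
  \<comment> \<open>Translation by \<open>w\<close> brings the lower bound in coordinate
    \<open>n\<close> to \<open>0\<close>, since \<open>measure_shear_interval\<close> wants it
    nonnegative. By linearity the image is merely shifted by \<open>h w\<close>.\<close>
  define w :: "real^'n" where "w = - axis n (a$n)"
  have "h ` cbox (w + a) (w + b) = h ` ((+) w ` cbox a b)"
    by (simp add: cbox_translation)
  also have "\<dots> = (+) (h w) ` (h ` cbox a b)"
    using lin by (auto simp: image_image linear_add)
  finally have "measure lebesgue (h ` cbox a b) = measure lebesgue (h ` cbox (w + a) (w + b))"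
    by (simp add: measure_translation)
  also have "\<dots> = measure lebesgue (cbox (w + a) (w + b))"
    unfolding h_def
  proof (rule measure_shear_interval[OF assms(1)])
    show "cbox (w + a) (w + b) \<noteq> {}" using False by (simp add: cbox_translation)
    show "0 \<le> (w + a) $ n" by (simp add: w_def axis_def)
  qed
  also have "\<dots> = measure lebesgue (cbox a b)"
    unfolding cbox_translation by (rule measure_translation)
  finally show ?thesis .
qed simp

text \<open>The library's determinant formula for the volume of linear images needs a wellordered index
  type. Here it suffices that every linear map multiplies volume by some constant.\<close>

lemma measure_linear_image_proportional:
  fixes f :: "real^'n \<Rightarrow> real^'n"
  assumes "linear f"
  shows "\<exists>k\<ge>0. \<forall>S\<in>lmeasurable. f ` S \<in> lmeasurable \<and>
           measure lebesgue (f ` S) = k * measure lebesgue S"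
  using assms
proof (rule induct_linear_elementary)
  fix f g :: "real^'n \<Rightarrow> real^'n"
  assume "\<exists>k\<ge>0. \<forall>S\<in>lmeasurable. f ` S \<in> lmeasurable \<and> measure lebesgue (f ` S) = k * measure lebesgue S"
    and "\<exists>k\<ge>0. \<forall>S\<in>lmeasurable. g ` S \<in> lmeasurable \<and> measure lebesgue (g ` S) = k * measure lebesgue S"
  then obtain j k where "0 \<le> j" "0 \<le> k"
    "\<forall>S\<in>lmeasurable. f ` S \<in> lmeasurable \<and> measure lebesgue (f ` S) = j * measure lebesgue S"
    "\<forall>S\<in>lmeasurable. g ` S \<in> lmeasurable \<and> measure lebesgue (g ` S) = k * measure lebesgue S"
    by blast
  then show "\<exists>k\<ge>0. \<forall>S\<in>lmeasurable. (f \<circ> g) ` S \<in> lmeasurable \<and>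
      measure lebesgue ((f \<circ> g) ` S) = k * measure lebesgue S"
    by (intro exI[of _ "j * k"]) (simp del: o_apply add: image_comp[symmetric] mult.assoc)
next
  fix f :: "real^'n \<Rightarrow> real^'n" and i
  assume f: "\<And>x. f x $ i = 0"
  have "negligible (f ` S)" for S
    by (rule negligible_subset[OF negligible_standard_hyperplane_cart[of i]]) (use f in auto)
  then have "f ` S \<in> lmeasurable \<and> measure lebesgue (f ` S) = 0 * measure lebesgue S" for S
    by (simp add: negligible_iff_measure)
  then show "\<exists>k\<ge>0. \<forall>S\<in>lmeasurable. f ` S \<in> lmeasurable \<and> measure lebesgue (f ` S) = k * measure lebesgue S"
    by blast
next
  fix c :: "'n \<Rightarrow> real"
  show "\<exists>k\<ge>0. \<forall>S\<in>lmeasurable. (\<lambda>x. \<chi> i. c i * x$i) ` S \<in> lmeasurable \<and>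
      measure lebesgue ((\<lambda>x. \<chi> i. c i * x$i) ` S) = k * measure lebesgue S"
    by (intro exI[of _ "\<bar>prod c UNIV\<bar>"]) (simp add: measurable_stretch measure_stretch)
next
  fix m n :: 'n assume "m \<noteq> n"
  let ?h = "\<lambda>x::real^'n. \<chi> i. x $ Transposition.transpose m n i"
  have lin: "linear ?h" by (rule linearI) (simp_all add: vec_eq_iff)
  have "measure lebesgue (?h ` cbox a b) = 1 * measure lebesgue (cbox a b)" for a b
  proof -
    \<comment> \<open>The coordinate swap is an involution taking boxes to boxes with the same side
      lengths up to order.\<close>
    have hh: "?h (?h x) = x" for x by (simp add: vec_eq_iff)
    have iff: "?h x \<in> cbox (?h a) (?h b) \<longleftrightarrow> x \<in> cbox a b" for x a b
      by (simp add: mem_box_cart) (metis transpose_involutory)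
    have "?h ` cbox a b = cbox (?h a) (?h b)"
    proof (intro set_eqI iffI)
      fix y assume "y \<in> cbox (?h a) (?h b)"
      then have "?h y \<in> cbox a b" using iff[of "?h y" a b] by (simp only: hh)
      then have "?h (?h y) \<in> ?h ` cbox a b" by (rule imageI)
      then show "y \<in> ?h ` cbox a b" by (simp only: hh)
    qed (use iff in blast)
    moreover have "(\<Prod>i\<in>UNIV. (b - a) $ Transposition.transpose m n i) = (\<Prod>i\<in>UNIV. (b - a) $ i)"
      by (rule prod.reindex_bij_betw) simp
    moreover have "cbox (?h a) (?h b) = {} \<longleftrightarrow> cbox a b = {}"
      by (simp only: calculation(1)[symmetric] image_is_empty)
    ultimately show ?thesis
      by (simp add: content_cbox_if_cart)
  qed
  then have "?h ` S \<in> lmeasurable \<and> 1 * measure lebesgue S = measure lebesgue (?h ` S)"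
    if "S \<in> lmeasurable" for S
    by (rule measure_linear_sufficient[OF lin that])
  then have "?h ` S \<in> lmeasurable" "measure lebesgue (?h ` S) = measure lebesgue S"
    if "S \<in> lmeasurable" for S
    using that by (auto simp only: mult_1)
  then show "\<exists>k\<ge>0. \<forall>S\<in>lmeasurable. ?h ` S \<in> lmeasurable \<and> measure lebesgue (?h ` S) = k * measure lebesgue S"
    by (intro exI[of _ 1] conjI ballI zero_le_one) (simp_all only: mult_1)
next
  fix m n :: 'n assume mn: "m \<noteq> n"
  let ?h = "\<lambda>x::real^'n. \<chi> i. if i = m then x$m + x$n else x$i"
  have lin: "linear ?h" by (rule linearI) (auto simp: vec_eq_iff algebra_simps)
  have "?h ` S \<in> lmeasurable \<and> 1 * measure lebesgue S = measure lebesgue (?h ` S)"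
    if "S \<in> lmeasurable" for S
    by (rule measure_linear_sufficient[OF lin that]) (simp only: measure_shear_cbox[OF mn] mult_1)
  then have "?h ` S \<in> lmeasurable" "measure lebesgue (?h ` S) = measure lebesgue S"
    if "S \<in> lmeasurable" for S
    using that by (auto simp only: mult_1)
  then show "\<exists>k\<ge>0. \<forall>S\<in>lmeasurable. ?h ` S \<in> lmeasurable \<and> measure lebesgue (?h ` S) = k * measure lebesgue S"
    by (intro exI[of _ 1] conjI ballI zero_le_one) (simp_all only: mult_1)
qed

text \<open>The constant \<open>k\<close> precedes the quantifier over \<open>\<rho>\<close>: it
  depends only on the directions, so it serves the radii of both bodies and of their geometric mean
  alike. It is the volume factor of the linear map sending the axes to the \<open>u i\<close>, times
  the volume of a standard simplex, or \<open>0\<close> if there are too few vectors.\<close>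

lemma corner_simplex_volume:
  fixes u :: "nat \<Rightarrow> real^'n"
  assumes "finite I" "card I \<le> CARD('n)"
  shows "\<exists>k\<ge>0. \<forall>\<rho>. (\<forall>i\<in>I. 0 < \<rho> i) \<longrightarrow> corner_simplex (\<lambda>i. \<rho> i *\<^sub>R u i) I \<in> lmeasurable \<and>
           measure lebesgue (corner_simplex (\<lambda>i. \<rho> i *\<^sub>R u i) I) = k * prod \<rho> I"
proof (cases "card I = CARD('n)")
  case True
  then obtain \<sigma> :: "'n \<Rightarrow> nat" where \<sigma>: "bij_betw \<sigma> UNIV I"
    using assms(1) finite_same_card_bij[of "UNIV :: 'n set" I] by auto
  define f :: "real^'n \<Rightarrow> real^'n" where "f = (\<lambda>x. \<Sum>j\<in>UNIV. x$j *\<^sub>R u (\<sigma> j))"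
  have "linear f"
    unfolding f_def by (rule linearI) (simp_all add: algebra_simps sum.distrib scaleR_sum_right)
  then obtain k where k: "0 \<le> k" "\<And>S. S \<in> lmeasurable \<Longrightarrow> f ` S \<in> lmeasurable \<and>
      measure lebesgue (f ` S) = k * measure lebesgue S"
    using measure_linear_image_proportional by blast
  define S :: "(real^'n) set" where "S = {x. (\<forall>j. 0 < x$j) \<and> (\<Sum>j\<in>UNIV. x$j) \<le> 1}"
  have "convex S"
    unfolding S_def convex_def
  proof (intro ballI allI impI CollectI conjI; elim CollectE conjE)
    fix x y :: "real^'n" and p q :: real and j
    assume *: "0 \<le> p" "0 \<le> q" "p + q = 1" "\<forall>j. 0 < x$j" "\<forall>j. 0 < y$j"
    have "0 < p * x$j + q * y$j"
      using * by (cases "p = 0") (auto intro!: add_pos_nonneg simp: less_imp_le)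
    then show "0 < (p *\<^sub>R x + q *\<^sub>R y) $ j" by simp
  next
    fix x y :: "real^'n" and p q :: real
    assume *: "0 \<le> p" "0 \<le> q" "p + q = 1" "(\<Sum>j\<in>UNIV. x$j) \<le> 1" "(\<Sum>j\<in>UNIV. y$j) \<le> 1"
    have "(\<Sum>j\<in>UNIV. (p *\<^sub>R x + q *\<^sub>R y) $ j) = p * (\<Sum>j\<in>UNIV. x$j) + q * (\<Sum>j\<in>UNIV. y$j)"
      by (simp add: sum.distrib sum_distrib_left)
    also have "\<dots> \<le> p * 1 + q * 1" using * by (intro add_mono mult_left_mono) auto
    finally show "(\<Sum>j\<in>UNIV. (p *\<^sub>R x + q *\<^sub>R y) $ j) \<le> 1" using * by simp
  qed
  moreover have "bounded S"
  proof (rule bounded_subset[OF bounded_cbox[of 0 1]], rule subsetI)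
    fix x assume x: "x \<in> S"
    have "x$j \<le> (\<Sum>j\<in>UNIV. x$j)" for j
      by (rule member_le_sum) (use x in \<open>auto simp: S_def less_imp_le\<close>)
    moreover have "\<forall>j. 0 < x$j" "(\<Sum>j\<in>UNIV. x$j) \<le> 1" using x by (auto simp: S_def)
    ultimately show "x \<in> cbox 0 1"
      by (auto simp: mem_box_cart less_imp_le intro: order_trans)
  qed
  ultimately have S: "S \<in> lmeasurable" by (rule measurable_convex)
  \<comment> \<open>The radii enter as a diagonal stretch of the standard simplex \<open>S\<close>
    performed before the fixed map \<open>f\<close>; the stretch contributes the product of the
    radii.\<close>
  have "corner_simplex (\<lambda>i. \<rho> i *\<^sub>R u i) I = f ` ((\<lambda>x. \<chi> j. \<rho> (\<sigma> j) * x$j) ` S)"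
    (is "?L = ?R") for \<rho>
  proof (intro set_eqI iffI)
    fix x assume "x \<in> ?L"
    then obtain c where c: "x = (\<Sum>i\<in>I. c i *\<^sub>R \<rho> i *\<^sub>R u i)" "\<forall>i\<in>I. 0 < c i" "sum c I \<le> 1"
      by (auto simp: corner_simplex_def)
    have "(\<chi> j. c (\<sigma> j)) \<in> S"
      using c(2,3) sum.reindex_bij_betw[OF \<sigma>, of c] bij_betwE[OF \<sigma>] by (simp add: S_def)
    moreover have "x = f (\<chi> j. \<rho> (\<sigma> j) * (\<chi> j. c (\<sigma> j)) $ j)"
      using sum.reindex_bij_betw[OF \<sigma>, of "\<lambda>i. c i *\<^sub>R \<rho> i *\<^sub>R u i"]
      by (simp add: f_def c(1) mult.commute)
    ultimately show "x \<in> ?R" by blast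
  next
    fix x assume "x \<in> ?R"
    then obtain y where y: "y \<in> S" "x = f (\<chi> j. \<rho> (\<sigma> j) * y$j)" by blast
    define c where "c = (\<lambda>i. y $ inv_into UNIV \<sigma> i)"
    have c: "c (\<sigma> j) = y $ j" for j
      using \<sigma> by (simp add: c_def bij_betw_def)
    have "x = (\<Sum>i\<in>I. c i *\<^sub>R \<rho> i *\<^sub>R u i)"
      using sum.reindex_bij_betw[OF \<sigma>, of "\<lambda>i. c i *\<^sub>R \<rho> i *\<^sub>R u i"]
      by (simp add: f_def c y(2) mult.commute)
    moreover have "\<forall>i\<in>I. 0 < c i" using y(1) by (simp add: c_def S_def)
    moreover have "sum c I \<le> 1"
      using y(1) sum.reindex_bij_betw[OF \<sigma>, of c] by (simp add: S_def c)
    ultimately show "x \<in> ?L" unfolding corner_simplex_def by blast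
  qed
  moreover have "\<bar>\<Prod>j\<in>UNIV. \<rho> (\<sigma> j)\<bar> = prod \<rho> I" if "\<forall>i\<in>I. 0 < \<rho> i" for \<rho> :: "nat \<Rightarrow> real"
    using prod.reindex_bij_betw[OF \<sigma>, of \<rho>] that prod_pos[of I \<rho>] by simp
  ultimately show ?thesis
    using k S by (intro exI[of _ "k * measure lebesgue S"])
      (simp add: measurable_stretch measure_stretch)
next
  case False
  \<comment> \<open>Fewer than \<open>CARD('n)\<close> vectors span only a proper subspace.\<close>
  have "negligible (corner_simplex (\<lambda>i. \<rho> i *\<^sub>R u i) I)" for \<rho>
  proof (rule negligible_lowdim)
    have "corner_simplex (\<lambda>i. \<rho> i *\<^sub>R u i) I \<subseteq> span (u ` I)"
      by (auto simp: corner_simplex_def intro!: span_sum span_scale intro: span_base)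
    then have "dim (corner_simplex (\<lambda>i. \<rho> i *\<^sub>R u i) I) \<le> card (u ` I)"
      by (rule dim_le_card) (use assms in simp)
    also have "\<dots> \<le> card I" using assms by (simp add: card_image_le)
    finally show "dim (corner_simplex (\<lambda>i. \<rho> i *\<^sub>R u i) I) < DIM(real^'n)"
      using False assms by simp
  qed
  then show ?thesis
    by (intro exI[of _ 0]) (simp add: negligible_iff_measure)
qed

section \<open>Hoelder's inequality and the volume bound for polytopes\<close>

text \<open>After division by the two sums, Young's inequality applies termwise and the bounds add
  up to \<open>l + (1 - l) = 1\<close>. A vanishing sum forces all its terms to vanish.\<close>

lemma Holder_sum_powr:
  fixes a b :: "'i \<Rightarrow> real"
  assumes fin: "finite I" and a: "\<And>i. i \<in> I \<Longrightarrow> 0 \<le> a i" and b: "\<And>i. i \<in> I \<Longrightarrow> 0 \<le> b i"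
    and l: "0 < l" "l < 1"
  shows "(\<Sum>i\<in>I. a i powr l * b i powr (1 - l)) \<le> sum a I powr l * sum b I powr (1 - l)"
proof (cases "sum a I = 0 \<or> sum b I = 0")
  case True
  then have "(\<Sum>i\<in>I. a i powr l * b i powr (1 - l)) = 0"
    using sum_nonneg_eq_0_iff[OF fin, of a] sum_nonneg_eq_0_iff[OF fin, of b] a b
    by (intro sum.neutral) auto
  then show ?thesis by simp
next
  case False
  define A where "A = sum a I"
  define B where "B = sum b I"
  have A: "0 < A" and B: "0 < B"
    using False a b by (auto simp: A_def B_def less_le sum_nonneg)
  have "a i powr l * b i powr (1 - l) \<le> A powr l * B powr (1 - l) * (l * (a i / A) + (1 - l) * (b i / B))"
    if i: "i \<in> I" for i
  proof (cases "a i = 0 \<or> b i = 0")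
    case True
    then show ?thesis using a[OF i] b[OF i] A B l by auto
  next
    case False
    then have "(a i / A) powr l * (b i / B) powr (1 - l) \<le> l * (a i / A) + (1 - l) * (b i / B)"
      using a[OF i] b[OF i] A B l by (intro Youngs_inequality_0) auto
    then have "A powr l * B powr (1 - l) * ((a i / A) powr l * (b i / B) powr (1 - l)) \<le>
        A powr l * B powr (1 - l) * (l * (a i / A) + (1 - l) * (b i / B))"
      by (intro mult_left_mono) auto
    then show ?thesis using a[OF i] b[OF i] A B by (simp add: powr_divide)
  qed
  then have "(\<Sum>i\<in>I. a i powr l * b i powr (1 - l)) \<le>
      (\<Sum>i\<in>I. A powr l * B powr (1 - l) * (l * (a i / A) + (1 - l) * (b i / B)))"
    by (rule sum_mono)
  also have "\<dots> = A powr l * B powr (1 - l) * (l * (sum a I / A) + (1 - l) * (sum b I / B))"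
    by (simp add: sum_distrib_left sum.distrib sum_divide_distrib distrib_left)
  also have "\<dots> = A powr l * B powr (1 - l)"
    using A B by (simp add: A_def[symmetric] B_def[symmetric])
  finally show ?thesis by (simp add: A_def B_def)
qed

text \<open>The faces are those of the middle vectors \<open>v i\<close>. The same index sets are
  kept for the radii \<open>r\<close> and \<open>s\<close>, although the resulting simplices need
  not form a convex set: disjointness and containment in \<open>A\<close> or \<open>B\<close>
  suffice.\<close>

lemma polytope_volume_log_le:
  fixes u :: "nat \<Rightarrow> real^'n" and A B :: "(real^'n) set"
  assumes l: "0 < l" "l < 1" and r: "\<And>i. 0 < r i" and s: "\<And>i. 0 < s i"
    and A: "convex A" "0 \<in> A" "A \<in> lmeasurable" "\<And>i. r i *\<^sub>R u i \<in> A"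
    and B: "convex B" "0 \<in> B" "B \<in> lmeasurable" "\<And>i. s i *\<^sub>R u i \<in> B"
  defines "v \<equiv> \<lambda>i. (r i powr l * s i powr (1 - l)) *\<^sub>R u i"
  shows "emeasure lebesgue (convex hull (insert 0 (v ` {..<N}))) \<le>
    ennreal (measure lebesgue A powr l * measure lebesgue B powr (1 - l))"
proof -
  define \<rho> where "\<rho> = (\<lambda>i. r i powr l * s i powr (1 - l))"
  have \<rho>: "0 < \<rho> i" for i using r[of i] s[of i] by (simp add: \<rho>_def)
  have v: "v = (\<lambda>i. \<rho> i *\<^sub>R u i)" by (simp add: v_def \<rho>_def)
  define F where "F = lex_faces v N"
  have finF: "finite F" by (simp add: F_def finite_lex_faces)
  have "\<forall>I\<in>F. \<exists>k\<ge>0. \<forall>\<rho>. (\<forall>i\<in>I. 0 < \<rho> i) \<longrightarrow> corner_simplex (\<lambda>i. \<rho> i *\<^sub>R u i) I \<in> lmeasurable \<and>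
           measure lebesgue (corner_simplex (\<lambda>i. \<rho> i *\<^sub>R u i) I) = k * prod \<rho> I"
    using lex_faces_finite[of _ v N] lex_faces_card_le[of _ v N]
    by (intro ballI corner_simplex_volume) (auto simp: F_def)
  from bchoice[OF this] obtain k where
    *: "\<forall>I\<in>F. 0 \<le> k I \<and> (\<forall>\<rho>. (\<forall>i\<in>I. 0 < \<rho> i) \<longrightarrow> corner_simplex (\<lambda>i. \<rho> i *\<^sub>R u i) I \<in> lmeasurable \<and>
           measure lebesgue (corner_simplex (\<lambda>i. \<rho> i *\<^sub>R u i) I) = k I * prod \<rho> I)" ..
  have k0: "0 \<le> k I" if "I \<in> F" for I using * that by simp
  have k: "corner_simplex (\<lambda>i. t i *\<^sub>R u i) I \<in> lmeasurable \<and>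
           measure lebesgue (corner_simplex (\<lambda>i. t i *\<^sub>R u i) I) = k I * prod t I"
    if "I \<in> F" "\<And>i. 0 < t i" for I t
    using * that by simp
  have vol_le: "(\<Sum>I\<in>F. k I * prod t I) \<le> measure lebesgue C"
    if t: "\<And>i. 0 < t i" and C: "convex C" "0 \<in> C" "C \<in> lmeasurable" "\<And>i. t i *\<^sub>R u i \<in> C" for t C
  proof -
    let ?S = "corner_simplex (\<lambda>i. t i *\<^sub>R u i)"
    have disj: "pairwise (\<lambda>I J. disjnt (?S I) (?S J)) F"
    proof (rule pairwiseI)
      fix I J assume IJ: "I \<in> F" "J \<in> F" "I \<noteq> J"
      show "disjnt (?S I) (?S J)"
      proof (rule ccontr)
        assume "\<not> disjnt (?S I) (?S J)"
        then obtain x where "x \<in> ?S I" "x \<in> ?S J" by (auto simp: disjnt_iff)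
        then obtain c d where c: "x = (\<Sum>i\<in>I. c i *\<^sub>R t i *\<^sub>R u i)" "\<forall>i\<in>I. 0 < c i"
          and d: "x = (\<Sum>i\<in>J. d i *\<^sub>R t i *\<^sub>R u i)" "\<forall>i\<in>J. 0 < d i"
          unfolding corner_simplex_def by blast
        \<comment> \<open>\<open>t i *\<^sub>R u i\<close> and \<open>v i\<close> lie on the same
          ray, so positive coefficients stay positive and the disjointness of the cones over
          \<open>v\<close> applies.\<close>
        have rescale: "c *\<^sub>R t i *\<^sub>R u i = (c * t i / \<rho> i) *\<^sub>R v i" for c i
          using \<rho>[of i] by (simp add: v)
        have "I = J"
        proof (rule lex_faces_cones_disjoint)
          show "(\<Sum>i\<in>I. (c i * t i / \<rho> i) *\<^sub>R v i) = (\<Sum>i\<in>J. (d i * t i / \<rho> i) *\<^sub>R v i)"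
            using c(1) d(1) by (simp only: rescale)
        qed (use IJ c d t \<rho> in \<open>auto simp: F_def\<close>)
        with IJ show False by simp
      qed
    qed
    have "(\<Sum>I\<in>F. k I * prod t I) = (\<Sum>I\<in>F. measure lebesgue (?S I))"
      using k t by simp
    also have "\<dots> = measure lebesgue (\<Union>I\<in>F. ?S I)"
      by (rule measure_UNION'[symmetric]) (use finF k t disj in auto)
    also have "\<dots> \<le> measure lebesgue C"
    proof (rule measure_mono_fmeasurable)
      show "(\<Union>I\<in>F. ?S I) \<subseteq> C"
        using C by (intro UN_least corner_simplex_subset_convex) (auto simp: F_def lex_faces_finite)
      show "(\<Union>I\<in>F. ?S I) \<in> sets lebesgue"
        using k t finF by (intro sets.finite_UN) (auto intro: fmeasurableD)
    qed (rule C)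
    finally show ?thesis .
  qed
  have "convex hull (insert 0 (v ` {..<N})) \<subseteq> (\<Union>I\<in>F. corner_simplex v I)"
  proof -
    \<comment> \<open>The image of the coefficient simplex \<open>D\<close> is convex and contains
      the generators, hence the hull.\<close>
    define D where "D = {c \<in> nonneg_coeffs N. sum c {..<N} \<le> 1}"
    have "convex hull (insert 0 (v ` {..<N})) \<subseteq> lincomb v N ` D"
    proof (rule hull_minimal)
      have "lincomb v N (\<lambda>i. 0) = 0" "(\<lambda>i. 0) \<in> D"
        by (auto simp: lincomb_def D_def nonneg_coeffs_def)
      then have "0 \<in> lincomb v N ` D" by force
      moreover have "v i \<in> lincomb v N ` D" if "i < N" for i
      proof
        show "v i = lincomb v N (indicator {i})"
          using that by (subst lincomb_eq_sum_subset[of "{i}"]) auto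
        show "indicator {i} \<in> D"
          using that by (auto simp: D_def nonneg_coeffs_def indicator_def sum.If_cases)
      qed
      ultimately show "insert 0 (v ` {..<N}) \<subseteq> lincomb v N ` D" by auto
      show "convex (lincomb v N ` D)"
        unfolding convex_def
      proof (safe)
        fix c d and p q :: real
        assume *: "c \<in> D" "d \<in> D" "0 \<le> p" "0 \<le> q" "p + q = 1"
        have "p * sum c {..<N} + q * sum d {..<N} \<le> p * 1 + q * 1"
          using * by (intro add_mono mult_left_mono) (auto simp: D_def)
        then have "(\<lambda>i. p * c i + q * d i) \<in> D"
          using * by (auto simp: D_def nonneg_coeffs_def sum.distrib sum_distrib_left)
        moreover have "p *\<^sub>R lincomb v N c + q *\<^sub>R lincomb v N d = lincomb v N (\<lambda>i. p * c i + q * d i)"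
          by (simp add: lincomb_add lincomb_scale)
        ultimately show "p *\<^sub>R lincomb v N c + q *\<^sub>R lincomb v N d \<in> lincomb v N ` D" by blast
      qed
    qed
    also have "\<dots> \<subseteq> (\<Union>I\<in>F. corner_simplex v I)"
      using lex_faces_cover by (fastforce simp: D_def F_def)
    finally show ?thesis .
  qed
  then have "emeasure lebesgue (convex hull (insert 0 (v ` {..<N}))) \<le>
      emeasure lebesgue (\<Union>I\<in>F. corner_simplex v I)"
    using k[of _ \<rho>] \<rho> finF
    by (intro emeasure_mono sets.finite_UN) (auto simp: v intro: fmeasurableD)
  also have "\<dots> \<le> (\<Sum>I\<in>F. emeasure lebesgue (corner_simplex v I))"
    using k[of _ \<rho>] \<rho> finF
    by (intro emeasure_subadditive_finite) (auto simp: v intro: fmeasurableD)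
  also have "\<dots> = (\<Sum>I\<in>F. ennreal (k I * prod \<rho> I))"
    using k[of _ \<rho>] \<rho> by (intro sum.cong) (auto simp: v emeasure_eq_measure2)
  also have "\<dots> = ennreal (\<Sum>I\<in>F. k I * prod \<rho> I)"
    using k0 \<rho> by (intro sum_ennreal) (auto intro!: mult_nonneg_nonneg prod_nonneg simp: less_imp_le)
  \<comment> \<open>Since the exponents add up to \<open>1\<close>, the constant splits as
    \<open>k I powr l * k I powr (1 - l)\<close>, one factor for each body.\<close>
  also have "(\<Sum>I\<in>F. k I * prod \<rho> I) = (\<Sum>I\<in>F. (k I * prod r I) powr l * (k I * prod s I) powr (1 - l))"
  proof (rule sum.cong)
    fix I assume I: "I \<in> F"
    have "prod \<rho> I = prod r I powr l * prod s I powr (1 - l)"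
      using r s by (simp add: \<rho>_def prod.distrib prod_powr_distrib less_imp_le)
    moreover have "k I = k I powr l * k I powr (1 - l)"
      using k0[OF I] by (simp flip: powr_add)
    moreover have "0 \<le> prod r I" "0 \<le> prod s I"
      using r s by (auto intro!: prod_nonneg simp: less_imp_le)
    ultimately show "k I * prod \<rho> I = (k I * prod r I) powr l * (k I * prod s I) powr (1 - l)"
      using k0[OF I] by (simp add: powr_mult)
  qed simp
  also have "\<dots> \<le> (\<Sum>I\<in>F. k I * prod r I) powr l * (\<Sum>I\<in>F. k I * prod s I) powr (1 - l)"
    using finF l k0 r s
    by (intro Holder_sum_powr) (auto intro!: mult_nonneg_nonneg prod_nonneg simp: less_imp_le)
  also have "\<dots> \<le> measure lebesgue A powr l * measure lebesgue B powr (1 - l)"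
    using vol_le[OF r A] vol_le[OF s B] l k0 r s
    by (intro mult_mono powr_mono2) (auto intro!: sum_nonneg mult_nonneg_nonneg prod_nonneg simp: less_imp_le)
  finally show ?thesis by (simp add: ennreal_leI)
qed

section \<open>From polytopes to closed convex hulls\<close>

text \<open>The hull of the sequence is the increasing union of the polytopes, so its measure is the
  supremum of theirs; taking the closure adds only boundary points, a null set for a convex
  set.\<close>

lemma emeasure_closure_convex_hull_le:
  fixes v :: "nat \<Rightarrow> real^'n"
  assumes "\<And>N. emeasure lebesgue (convex hull (insert 0 (v ` {..<N}))) \<le> M"
  shows "emeasure lebesgue (closure (convex hull (insert 0 (range v)))) \<le> M"
proof -
  define P where "P = (\<lambda>N. convex hull (insert 0 (v ` {..<N})))"
  define W where "W = convex hull (insert 0 (range v))"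
  have mono: "P m \<subseteq> P n" if "m \<le> n" for m n
    unfolding P_def using that by (intro hull_mono) auto
  have "W \<subseteq> (\<Union>N. P N)"
    unfolding W_def
  proof (rule hull_minimal)
    show "insert 0 (range v) \<subseteq> (\<Union>N. P N)"
    proof -
      have "v i \<in> P (Suc i)" for i unfolding P_def by (intro hull_inc) auto
      moreover have "0 \<in> P 0" unfolding P_def by (intro hull_inc) auto
      ultimately show ?thesis by blast
    qed
    show "convex (\<Union>N. P N)"
      unfolding convex_def
    proof (safe)
      fix x y m n and p q :: real
      assume *: "x \<in> P m" "y \<in> P n" "0 \<le> p" "0 \<le> q" "p + q = 1"
      have "x \<in> P (max m n)" "y \<in> P (max m n)" using mono * by (meson max.cobounded1 max.cobounded2 subsetD)+
      then have "p *\<^sub>R x + q *\<^sub>R y \<in> P (max m n)"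
        using * by (intro convexD) (auto simp: P_def)
      then show "p *\<^sub>R x + q *\<^sub>R y \<in> (\<Union>N. P N)" by blast
    qed
  qed
  moreover have "P N \<subseteq> W" for N
    unfolding P_def W_def by (intro hull_mono) auto
  ultimately have W: "W = (\<Union>N. P N)" by blast
  have Psets: "P N \<in> sets lebesgue" for N
    unfolding P_def by (intro lmeasurable_compact fmeasurableD compact_convex_hull finite_imp_compact) auto
  then have Wsets: "W \<in> sets lebesgue" by (auto simp: W)
  have fr: "frontier W \<in> null_sets lebesgue"
    using negligible_convex_frontier[of W] by (simp add: W_def negligible_iff_null_sets)
  have "closure W \<subseteq> W \<union> frontier W"
    using interior_subset by (auto simp: frontier_def)
  then have "emeasure lebesgue (closure W) \<le> emeasure lebesgue (W \<union> frontier W)"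
    using Wsets fr by (intro emeasure_mono) auto
  also have "\<dots> = emeasure lebesgue W"
    using Wsets fr by (rule emeasure_Un_null_set)
  also have "\<dots> = (SUP N. emeasure lebesgue (P N))"
    unfolding W by (rule SUP_emeasure_incseq[symmetric]) (use Psets mono in \<open>auto simp: incseq_def\<close>)
  also have "\<dots> \<le> M"
    using assms by (intro SUP_least) (simp add: P_def)
  finally show ?thesis by (simp add: W_def)
qed

section \<open>Polar sets\<close>

lemma closed_polar_set: "closed (polar_set K)"
proof -
  have "polar_set K = (\<Inter>y\<in>K. {x. y \<bullet> x \<le> 1})" by (auto simp: polar_set_def inner_commute)
  then show ?thesis by (auto intro: closed_INT closed_halfspace_le)
qed

lemma sets_lebesgue_polar_set: "polar_set K \<in> sets lebesgue"
  using closed_polar_set[of K] by (intro sets_completionI_sets) (simp add: borel_closed)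

lemma convex_polar_set: "convex (polar_set K)"
proof -
  have "polar_set K = (\<Inter>y\<in>K. {x. y \<bullet> x \<le> 1})" by (auto simp: polar_set_def inner_commute)
  then show ?thesis by (auto intro: convex_INT convex_halfspace_le)
qed

lemma ball_subset_polar_set:
  assumes "bounded K"
  obtains e where "0 < e" "ball 0 e \<subseteq> polar_set K"
proof -
  obtain R where R: "0 < R" "\<And>y. y \<in> K \<Longrightarrow> norm y \<le> R"
    using assms by (auto simp: bounded_pos)
  have "x \<bullet> y \<le> 1" if "norm x < 1 / R" "y \<in> K" for x y
  proof -
    have "x \<bullet> y \<le> norm x * norm y" by (rule norm_cauchy_schwarz)
    also have "\<dots> \<le> 1 / R * R" using that R by (intro mult_mono) auto
    finally show ?thesis using R by simp
  qed
  with R show ?thesis by (intro that[of "1 / R"]) (auto simp: polar_set_def)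
qed

text \<open>Serves the case in which the other polar has infinite volume: as
  \<open>0 * \<infinity> = 0\<close> in \<open>ennreal\<close>, a vanishing factor would spoil the
  infinite right-hand side.\<close>

lemma emeasure_polar_set_nonzero:
  fixes K :: "(real^'n) set"
  assumes "convex_body K"
  shows "emeasure lebesgue (polar_set K) \<noteq> 0"
proof
  assume "emeasure lebesgue (polar_set K) = 0"
  moreover obtain e where e: "0 < e" "ball 0 e \<subseteq> polar_set K"
    using assms ball_subset_polar_set by (auto simp: convex_body_def dest: compact_imp_bounded)
  ultimately have "negligible (polar_set K)"
    by (simp add: negligible_iff_null_sets null_sets_def sets_lebesgue_polar_set)
  then have "negligible (ball (0::real^'n) e)" using e negligible_subset by blast
  then show False using e open_not_negligible[of "ball (0::real^'n) e"] by auto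
qed

text \<open>If the origin is not interior to \<open>K\<close>, the polar set recedes in the direction of an outer normal
  and so contains infinitely many disjoint balls of the same radius.\<close>

lemma emeasure_polar_set_infinite:
  fixes K :: "(real^'n) set"
  assumes K: "convex_body K" and 0: "0 \<notin> interior K"
  shows "emeasure lebesgue (polar_set K) = \<infinity>"
proof (rule ccontr)
  assume "emeasure lebesgue (polar_set K) \<noteq> \<infinity>"
  then have meas: "polar_set K \<in> lmeasurable"
    by (intro fmeasurableI sets_lebesgue_polar_set) (simp add: top.not_eq_extremum)
  have K': "compact K" "convex K" "interior K \<noteq> {}" using K by (auto simp: convex_body_def)
  obtain a where a: "a \<noteq> 0" "\<And>y. y \<in> interior K \<Longrightarrow> 0 \<le> a \<bullet> y"
    using separating_hyperplane_set_0[of "interior K"] 0 K' convex_interior by blast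
  \<comment> \<open>The separation concerns the interior only; it passes to all of \<open>K\<close>
    by taking closures.\<close>
  have "K \<subseteq> closure (interior K)"
    using convex_closure_interior[OF K'(2,3)] closure_subset by blast
  also have "\<dots> \<subseteq> {y. 0 \<le> a \<bullet> y}"
    using a by (intro closure_minimal closed_halfspace_ge) auto
  finally have aK: "\<And>y. y \<in> K \<Longrightarrow> 0 \<le> a \<bullet> y" by blast
  define w where "w = - (1 / norm a) *\<^sub>R a"
  have w: "norm w = 1" "\<And>y. y \<in> K \<Longrightarrow> w \<bullet> y \<le> 0"
    using a aK by (auto simp: w_def)
  obtain e where e: "0 < e" "ball 0 e \<subseteq> polar_set K"
    using K' ball_subset_polar_set compact_imp_bounded by blast
  \<comment> \<open>Centres at distance \<open>2 * e\<close> along the unit vector \<open>w\<close>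
    keep open balls of radius \<open>e\<close> disjoint; moving along \<open>w\<close> never
    increases inner products with points of \<open>K\<close>.\<close>
  define c where "c = (\<lambda>k::nat. (2 * e * real k) *\<^sub>R w)"
  have sub: "ball (c k) e \<subseteq> polar_set K" for k
  proof
    fix x assume "x \<in> ball (c k) e"
    then have "x - c k \<in> ball 0 e" by (simp add: dist_norm norm_minus_commute)
    then have "x - c k \<in> polar_set K" using e by blast
    moreover have "c k \<bullet> y \<le> 0" if "y \<in> K" for y
      using w(2)[OF that] e by (simp add: c_def mult_nonneg_nonpos)
    ultimately show "x \<in> polar_set K"
      by (force simp: polar_set_def inner_diff_left)
  qed
  have disj: "pairwise (\<lambda>i j. disjnt (ball (c i) e) (ball (c j) e)) I" for I
  proof (rule pairwiseI)
    fix i j :: nat assume "i \<noteq> j"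
    then have "1 \<le> \<bar>real i - real j\<bar>" by linarith
    then have "2 * e * 1 \<le> 2 * e * \<bar>real i - real j\<bar>" using e by (intro mult_left_mono) auto
    also have "\<dots> = dist (c i) (c j)"
      using w e by (simp add: c_def dist_norm abs_mult flip: scaleR_left_diff_distrib right_diff_distrib)
    finally show "disjnt (ball (c i) e) (ball (c j) e)"
      using e by (simp add: disjnt_def disjoint_ballI)
  qed
  define m where "m = measure lebesgue (ball (0::real^'n) e)"
  have m: "0 < m" using e content_ball_pos[of e "0::real^'n"] by (simp add: m_def)
  have ballm: "measure lebesgue (ball (c k) e) = m" for k
    using measure_translation[of "c k" "ball 0 e"] by (simp add: m_def image_add_ball)
  have "real n * m \<le> measure lebesgue (polar_set K)" for n
  proof -
    have "real n * m = (\<Sum>k<n. measure lebesgue (ball (c k) e))" by (simp add: ballm)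
    also have "\<dots> = measure lebesgue (\<Union>k<n. ball (c k) e)"
      by (rule measure_UNION'[symmetric]) (use disj in auto)
    also have "\<dots> \<le> measure lebesgue (polar_set K)"
      using sub meas by (intro measure_mono_fmeasurable) auto
    finally show ?thesis .
  qed
  moreover obtain n where "measure lebesgue (polar_set K) < real n * m"
    using reals_Archimedean3[OF m] by blast
  ultimately show False by (meson not_less)
qed

section \<open>Support functions and polars of Wulff shapes\<close>

lemma inner_le_support_fun:
  assumes "convex_body K" "y \<in> K"
  shows "u \<bullet> y \<le> support_fun K u"
  using support_fun_is_max[OF assms(1), of u] assms(2) by auto

lemma support_fun_pos:
  assumes K: "convex_body K" and 0: "0 \<in> interior K" and u: "u \<noteq> 0"
  shows "0 < support_fun K u"
proof -
  obtain e where e: "0 < e" "cball 0 e \<subseteq> K"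
    using 0 by (meson mem_interior_cball)
  have "(e / norm u) *\<^sub>R u \<in> K" using e u by auto
  from inner_le_support_fun[OF K this, of u] have "e / norm u * (u \<bullet> u) \<le> support_fun K u" by simp
  moreover have "0 < e / norm u * (u \<bullet> u)" using e u by simp
  ultimately show ?thesis by linarith
qed

lemma inverse_support_in_polar_set:
  assumes "convex_body K" "0 < support_fun K u"
  shows "(1 / support_fun K u) *\<^sub>R u \<in> polar_set K"
  using assms inner_le_support_fun[OF assms(1), of _ u] by (auto simp: polar_set_def field_simps)

text \<open>Bipolar argument: a hyperplane separating \<open>x\<close> from \<open>Q\<close> has a
  negative level \<open>b\<close> because \<open>0 \<in> Q\<close>. The normalised normal
  \<open>y\<close> satisfies \<open>y \<bullet> q < 1\<close> on \<open>Q\<close> and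
  \<open>y \<bullet> x > 1\<close>. Testing the points \<open>u / f u\<close> puts \<open>y\<close>
  into the Wulff shape, contradicting the choice of \<open>x\<close>.\<close>

lemma polar_Wulff_shape_subset:
  fixes Q :: "(real^'n) set"
  assumes Q: "closed Q" "convex Q" "0 \<in> Q"
    and f: "\<And>u. u \<in> sphere 0 1 \<Longrightarrow> 0 < f u" "\<And>u. u \<in> sphere 0 1 \<Longrightarrow> (1 / f u) *\<^sub>R u \<in> Q"
  shows "polar_set {x. \<forall>u\<in>sphere 0 1. x \<bullet> u \<le> f u} \<subseteq> Q"
proof
  fix x assume x: "x \<in> polar_set {x. \<forall>u\<in>sphere 0 1. x \<bullet> u \<le> f u}"
  show "x \<in> Q"
  proof (rule ccontr)
    assume "x \<notin> Q"
    then obtain a b where ab: "a \<bullet> x < b" "\<And>q. q \<in> Q \<Longrightarrow> b < a \<bullet> q"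
      using separating_hyperplane_closed_point Q by metis
    have b: "b < 0" using ab(2)[OF Q(3)] by simp
    define y where "y = (1 / b) *\<^sub>R a"
    have "y \<bullet> u \<le> f u" if u: "u \<in> sphere 0 1" for u
      using ab(2)[OF f(2)[OF u]] f(1)[OF u] b by (simp add: y_def field_simps)
    then have "x \<bullet> y \<le> 1" using x by (auto simp: polar_set_def)
    then show False using ab(1) b by (simp add: y_def inner_commute field_simps)
  qed
qed

section \<open>The volume inequality for logarithmic combinations\<close>

lemma polar_log_comb_volume_le:
  fixes K L :: "(real^'n) set"
  assumes K: "convex_body K" "0 \<in> interior K" "polar_set K \<in> lmeasurable"
    and L: "convex_body L" "0 \<in> interior L" "polar_set L \<in> lmeasurable"
    and l: "0 < l" "l < 1"
  shows "emeasure lebesgue (polar_set (log_comb l K L)) \<le>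
    ennreal (measure lebesgue (polar_set K) powr l * measure lebesgue (polar_set L) powr (1 - l))"
proof -
  define f where "f = (\<lambda>u. support_fun K u powr l * support_fun L u powr (1 - l))"
  have pos: "0 < support_fun K u" "0 < support_fun L u" if "u \<in> sphere 0 1" for u
    using that K L by (auto intro!: support_fun_pos)
  have fpos: "0 < f u" if "u \<in> sphere 0 1" for u
    using pos[OF that] by (simp add: f_def)
  define S where "S = (\<lambda>u. (1 / f u) *\<^sub>R u) ` sphere 0 1"
  \<comment> \<open>A countable dense subset suffices, since the closed hull \<open>Q\<close> of its
    points contains all of \<open>S\<close>.\<close>
  obtain T where T: "countable T" "T \<subseteq> S" "S \<subseteq> closure T"
    using separable by blast
  \<comment> \<open>\<open>T\<close> must be nonempty to be enumerated by
    \<open>from_nat_into\<close>, which repeats values if \<open>T\<close> is finite.\<close>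
  have "axis undefined 1 \<in> (sphere 0 1 :: (real^'n) set)" by simp
  then have "S \<noteq> {}" unfolding S_def by blast
  then have "T \<noteq> {}" using T by auto
  then have "\<exists>u\<in>sphere 0 1. from_nat_into T n = (1 / f u) *\<^sub>R u" for n
    using from_nat_into[of T n] T(2) by (auto simp: S_def)
  then obtain u where u: "\<And>n. u n \<in> sphere 0 1" "\<And>n. from_nat_into T n = (1 / f (u n)) *\<^sub>R u n"
    by metis
  \<comment> \<open>This is \<open>u i / f (u i)\<close>, written with the radii
    \<open>1 / support_fun K (u i)\<close> and \<open>1 / support_fun L (u i)\<close> that lead to
    points of the two polars.\<close>
  define v where "v = (\<lambda>i. ((1 / support_fun K (u i)) powr l * (1 / support_fun L (u i)) powr (1 - l)) *\<^sub>R u i)"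
  have v: "v = from_nat_into T"
  proof
    show "v i = from_nat_into T i" for i
      using pos[OF u(1), of i] by (simp add: v_def u(2) f_def powr_divide)
  qed
  define Q where "Q = closure (convex hull (insert 0 (range v)))"
  have "T \<subseteq> convex hull (insert 0 (range v))"
    using range_from_nat_into[OF \<open>T \<noteq> {}\<close> T(1)] by (auto simp: v intro: hull_inc)
  then have SQ: "S \<subseteq> Q" using T(3) closure_mono unfolding Q_def by blast
  have "polar_set (log_comb l K L) \<subseteq> Q"
    unfolding log_comb_def
  proof (rule polar_Wulff_shape_subset[of Q f, unfolded f_def])
    show "0 \<in> Q" unfolding Q_def by (intro subsetD[OF closure_subset] hull_inc) simp
  qed (use fpos SQ in \<open>auto simp: Q_def S_def f_def image_subset_iff\<close>)
  then have "emeasure lebesgue (polar_set (log_comb l K L)) \<le> emeasure lebesgue Q"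
    by (rule emeasure_mono) (simp add: Q_def)
  also have "\<dots> \<le> ennreal (measure lebesgue (polar_set K) powr l * measure lebesgue (polar_set L) powr (1 - l))"
    unfolding Q_def v_def
  proof (intro emeasure_closure_convex_hull_le polytope_volume_log_le l)
    fix i
    show "(1 / support_fun K (u i)) *\<^sub>R u i \<in> polar_set K" "(1 / support_fun L (u i)) *\<^sub>R u i \<in> polar_set L"
      using pos[OF u(1)] K L by (auto intro: inverse_support_in_polar_set)
      show "0 \<in> polar_set K" "0 \<in> polar_set L" by (auto simp: polar_set_def)
  qed (use pos[OF u(1)] K L in \<open>auto simp: convex_polar_set\<close>)
  finally show ?thesis .
qed

lemma ennpowr_nonzero: "x \<noteq> 0 \<Longrightarrow> ennpowr x a \<noteq> 0"
  by (cases x) (auto simp: ennpowr_def ennreal_eq_0_iff)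

theorem theorem6p1:
  fixes K L :: "(real ^ 'n) set" and l :: real
  assumes "convex_body K" and "convex_body L" and "0 < l" and "l < 1"
  shows "emeasure lebesgue (polar_set (log_comb l K L))
           \<le> ennpowr (emeasure lebesgue (polar_set K)) l
             * ennpowr (emeasure lebesgue (polar_set L)) (1 - l)"
proof (cases "emeasure lebesgue (polar_set K) = \<infinity> \<or> emeasure lebesgue (polar_set L) = \<infinity>")
  case True
  \<comment> \<open>One factor is infinite and neither vanishes.\<close>
  then have "ennpowr (emeasure lebesgue (polar_set K)) l *
      ennpowr (emeasure lebesgue (polar_set L)) (1 - l) = \<infinity>"
    using ennpowr_nonzero[OF emeasure_polar_set_nonzero[OF assms(1)], of l]
      ennpowr_nonzero[OF emeasure_polar_set_nonzero[OF assms(2)], of "1 - l"]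
    by (auto simp: ennpowr_def ennreal_mult_eq_top_iff)
  then show ?thesis by simp
next
  case False
  \<comment> \<open>Finite polar volumes force the origin into both interiors, where the support
    functions are positive on the sphere.\<close>
  have int: "0 \<in> interior K" "0 \<in> interior L"
    using False emeasure_polar_set_infinite assms by blast+
  have meas: "polar_set K \<in> lmeasurable" "polar_set L \<in> lmeasurable"
    using False by (auto intro!: fmeasurableI simp: sets_lebesgue_polar_set top.not_eq_extremum)
  have "ennpowr (emeasure lebesgue C) p = ennreal (measure lebesgue C powr p)"
    if "emeasure lebesgue C \<noteq> \<infinity>" for C :: "(real^'n) set" and p
    using that by (simp add: ennpowr_def measure_def)
  then show ?thesis
    using polar_log_comb_volume_le[OF assms(1) int(1) meas(1) assms(2) int(2) meas(2) assms(3,4)] False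
    by (simp add: ennreal_mult)
qed

end
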